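(* Consider the rank-1 inhomogeneous random graph on $n$ vertices with i.i.d. weights $H_1,\dots,H_n$ satisfying $\overline F(h)=\mathbb P(H>h)=l(h)h^{1-\tau}$ for $h\ge 1$, where $\tau\in(2,3)$ and $l$ is slowly varying, with mean $\mu=\mathbb E[H]$ and connection probability $p(h,h')=\min\{hh'/(\mu n),1\}$. For every fixed integer $k\ge 3$, the average number $A_k(n)$ of cliques of size $k$ satisfies $$A_k(n)\asymp n^k\left(\overline F(\sqrt n)\right)^k = n^{\frac{k}{2}(3-\tau)}\,l^k(\sqrt n)\qquad\text{as } n\to\infty .$$
   Context: Model: the graph has $n$ vertices with i.i.d. weights $H_1,\dots,H_n$ supported on $[1,\infty)$ with the distribution of $H$; conditionally on the weights, each pair of vertices $i\ne j$ is connected by an edge independently with probability $p(H_i,H_j)=\min\{H_iH_j/(\mu n),1\}$, where $\mu=\mathbb E[H]$. A function $l$ is slowly varying if $l(ch)/l(h)\to 1$ as $h\to\infty$ for every fixed $0<c<\infty$. The average number of $k$-cliques is $A_k(n)=\binom nk\,\mathbb P(K_k)$, where $\mathbb P(K_k)=\mathbb E\big[\prod_{1\le i<j\le k}p(H_i,H_j)\big]$ is the probability that $k$ given vertices are all pairwise connected. Notation: $g_1(n)\asymp g_2(n)$ as $n\to\infty$ means that there exist constants $C_1>0$ and $C_2<\infty$ such that $C_1\le\liminf_{n\to\infty} g_1(n)/g_2(n)\le\limsup_{n\to\infty}g_1(n)/g_2(n)\le C_2$. $l^k$ denotes the $k$-th power of $l$. *)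

theory Defs
  imports "HOL-Probability.Probability"
begin

section \<open>The rank-1 inhomogeneous random graph\<close>

text \<open>
  Throughout, \<open>D\<close> is the law of the weight \<open>H\<close>, a probability measure on the real line.
  The vertex set is \<open>{..<n}\<close>, and a simple graph is represented by the set of its edges,
  an edge between \<open>i\<close> and \<open>j\<close> being recorded once, as the pair \<open>(i, j)\<close> with \<open>i < j\<close>.
\<close>

text \<open>
  The Bochner integral is 0 for a non-integrable \<open>H\<close>; a regularly varying tail with exponent
  \<open>1 - \<tau> < -1\<close> makes \<open>H\<close> integrable.
\<close>

definition mean :: "real measure \<Rightarrow> real" where
  "mean D = (\<integral>h. h \<partial>D)"

definition tail :: "real measure \<Rightarrow> real \<Rightarrow> real" where
  "tail D h = measure D {h<..}"

definition conn_prob :: "real \<Rightarrow> nat \<Rightarrow> real \<Rightarrow> real \<Rightarrow> real" where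
  "conn_prob \<mu> n h h' = min (h * h' / (\<mu> * real n)) 1"

definition vertex_pairs :: "nat set \<Rightarrow> (nat \<times> nat) set" where
  "vertex_pairs S = {(i, j). i \<in> S \<and> j \<in> S \<and> i < j}"

text \<open>
  The conditional law of the edge set given the weights. The second argument of \<open>Pi_pmf\<close> is
  the value outside of the index set and plays no role; \<open>bernoulli_pmf\<close> truncates its
  parameter to the unit interval, which has no effect for weights that are at least 1.
\<close>

definition edge_law :: "real \<Rightarrow> nat \<Rightarrow> (nat \<Rightarrow> real) \<Rightarrow> (nat \<times> nat) set pmf" where
  "edge_law \<mu> n w =
     map_pmf (\<lambda>x. {e \<in> vertex_pairs {..<n}. x e})
       (Pi_pmf (vertex_pairs {..<n}) False
         (\<lambda>(i, j). bernoulli_pmf (conn_prob \<mu> n (w i) (w j))))"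

definition random_graph :: "real measure \<Rightarrow> nat \<Rightarrow> (nat \<times> nat) set measure" where
  "random_graph D n =
     (\<Pi>\<^sub>M i\<in>{..<n}. D) \<bind> (\<lambda>w. measure_pmf (edge_law (mean D) n w))"

definition cliques :: "nat \<Rightarrow> nat \<Rightarrow> (nat \<times> nat) set \<Rightarrow> nat set set" where
  "cliques k n E = {S. S \<subseteq> {..<n} \<and> card S = k \<and> vertex_pairs S \<subseteq> E}"

definition avg_cliques :: "real measure \<Rightarrow> nat \<Rightarrow> nat \<Rightarrow> real" where
  "avg_cliques D k n = (\<integral>E. real (card (cliques k n E)) \<partial>random_graph D n)"

definition clique_prob :: "real measure \<Rightarrow> nat \<Rightarrow> nat \<Rightarrow> real" where
  "clique_prob D k n =
     (\<integral>w. (\<Prod>(i, j)\<in>vertex_pairs {..<k}. conn_prob (mean D) n (w i) (w j))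
        \<partial>(\<Pi>\<^sub>M i\<in>{..<k}. D))"


section \<open>Asymptotic notions\<close>

definition slowly_varying :: "(real \<Rightarrow> real) \<Rightarrow> bool" where
  "slowly_varying l \<longleftrightarrow> (\<forall>c>0. ((\<lambda>h. l (c * h) / l h) \<longlongrightarrow> 1) at_top)"

definition same_order :: "(nat \<Rightarrow> real) \<Rightarrow> (nat \<Rightarrow> real) \<Rightarrow> bool"  (infix "\<asymp>" 50) where
  "f \<asymp> g \<longleftrightarrow>
     (\<exists>C1 C2 :: real. C1 > 0 \<and>
        ereal C1 \<le> liminf (\<lambda>n. ereal (f n / g n)) \<and>
        liminf (\<lambda>n. ereal (f n / g n)) \<le> limsup (\<lambda>n. ereal (f n / g n)) \<and>
        limsup (\<lambda>n. ereal (f n / g n)) \<le> ereal C2)"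


section \<open>The average number of cliques as a binomial coefficient times a clique probability\<close>

lemma finite_vertex_pairs [simp]: "finite S \<Longrightarrow> finite (vertex_pairs S)"
  by (rule finite_subset[of _ "S \<times> S"]) (auto simp: vertex_pairs_def)

lemma conn_prob_measurable [measurable]:
  assumes [measurable]: "f \<in> borel_measurable M" "g \<in> borel_measurable M"
  shows "(\<lambda>x. conn_prob \<mu> n (f x) (g x)) \<in> borel_measurable M"
  unfolding conn_prob_def by measurable

lemma pmf_bernoulli_clamp: "pmf (bernoulli_pmf p) b =
    (if b then min 1 (max 0 p) else 1 - min 1 (max 0 p))"
  by (simp add: bernoulli_pmf.rep_eq)

lemma prob_edge_law_superset:
  assumes "T \<subseteq> vertex_pairs {..<n}"
  shows "measure_pmf.prob (edge_law \<mu> n w) {E. T \<subseteq> E} =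
           (\<Prod>(i, j)\<in>T. pmf (bernoulli_pmf (conn_prob \<mu> n (w i) (w j))) True)"
proof -
  let ?A = "vertex_pairs {..<n}"
  let ?B = "\<lambda>e. if e \<in> T then {True} else UNIV"
  let ?p = "\<lambda>(i, j). bernoulli_pmf (conn_prob \<mu> n (w i) (w j))"
  have "(\<lambda>x. {e \<in> ?A. x e}) -` {E. T \<subseteq> E} = Pi ?A ?B"
    using assms by (auto simp: Pi_def split: if_splits)
  then have "measure_pmf.prob (edge_law \<mu> n w) {E. T \<subseteq> E} =
      measure_pmf.prob (Pi_pmf ?A False ?p) (Pi ?A ?B)"
    by (simp add: edge_law_def)
  also have "\<dots> = (\<Prod>e\<in>?A. measure_pmf.prob (?p e) (?B e))"
    by (rule measure_Pi_pmf_Pi) simp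
  also have "\<dots> = (\<Prod>e\<in>T. measure_pmf.prob (?p e) (?B e))"
    using assms by (intro prod.mono_neutral_right) auto
  also have "\<dots> = (\<Prod>e\<in>T. pmf (?p e) True)"
    by (intro prod.cong) (auto simp: measure_pmf_single)
  finally show ?thesis by (simp add: case_prod_unfold)
qed

lemma pmf_edge_law:
  "pmf (edge_law \<mu> n w) E =
     (if E \<subseteq> vertex_pairs {..<n}
      then \<Prod>(i, j)\<in>vertex_pairs {..<n}.
             pmf (bernoulli_pmf (conn_prob \<mu> n (w i) (w j))) ((i, j) \<in> E)
      else 0)"
proof -
  let ?A = "vertex_pairs {..<n}"
  let ?p = "\<lambda>(i, j). bernoulli_pmf (conn_prob \<mu> n (w i) (w j))"
  have "(\<lambda>x. {e \<in> ?A. x e}) -` {E} = (if E \<subseteq> ?A then Pi ?A (\<lambda>e. {e \<in> E}) else {})"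
  proof (cases "E \<subseteq> ?A")
    case True
    then have "{e \<in> ?A. x e} = E \<longleftrightarrow> (\<forall>e\<in>?A. x e = (e \<in> E))" for x by blast
    then show ?thesis using True by (auto simp: Pi_def vimage_def)
  next
    case False
    then have "{e \<in> ?A. x e} \<noteq> E" for x by blast
    then show ?thesis using False by (simp add: vimage_def)
  qed
  then have "pmf (edge_law \<mu> n w) E =
      measure_pmf.prob (Pi_pmf ?A False ?p) (if E \<subseteq> ?A then Pi ?A (\<lambda>e. {e \<in> E}) else {})"
    by (simp add: edge_law_def pmf_map)
  also have "\<dots> = (if E \<subseteq> ?A then \<Prod>e\<in>?A. pmf (?p e) (e \<in> E) else 0)"
    by (auto simp: measure_Pi_pmf_Pi measure_pmf_single)
  finally show ?thesis by (simp add: case_prod_unfold)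
qed

lemma vertex_pairs_mono: "S \<subseteq> T \<Longrightarrow> vertex_pairs S \<subseteq> vertex_pairs T"
  by (auto simp: vertex_pairs_def)

context real_distribution
begin

lemma borel_component:
  "i \<in> I \<Longrightarrow> (\<lambda>w. w i) \<in> borel_measurable (\<Pi>\<^sub>M i\<in>I. M)"
  using measurable_component_singleton[of i I "\<lambda>_. M"]
  by (simp add: measurable_cong_sets[OF refl events_eq_borel])

lemma bernoulli_conn_prob_measurable:
  assumes "i \<in> I" "j \<in> I"
  shows "(\<lambda>w. pmf (bernoulli_pmf (conn_prob \<mu> n (w i) (w j))) b) \<in> borel_measurable (\<Pi>\<^sub>M i\<in>I. M)"
proof -
  have "(\<lambda>w. conn_prob \<mu> n (w i) (w j)) \<in> borel_measurable (\<Pi>\<^sub>M i\<in>I. M)"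
    by (intro conn_prob_measurable borel_component assms)
  then show ?thesis unfolding pmf_bernoulli_clamp by (cases b) simp_all
qed

lemma edge_law_measurable:
  "(\<lambda>w. measure_pmf (edge_law \<mu> n w)) \<in>
     (\<Pi>\<^sub>M i\<in>{..<n}. M) \<rightarrow>\<^sub>M subprob_algebra (count_space UNIV)"
proof (rule measurable_subprob_algebra)
  fix X :: "(nat \<times> nat) set set"
  let ?A = "vertex_pairs {..<n}"
  have "emeasure (measure_pmf (edge_law \<mu> n w)) X =
      ennreal (\<Sum>E\<in>X \<inter> Pow ?A. pmf (edge_law \<mu> n w) E)" for w
  proof -
    have "emeasure (measure_pmf (edge_law \<mu> n w)) X =
        emeasure (measure_pmf (edge_law \<mu> n w)) (X \<inter> Pow ?A)"
      by (intro emeasure_eq_AE AE_pmfI) (auto simp: set_pmf_iff pmf_edge_law split: if_splits)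
    also have "\<dots> = ennreal (\<Sum>E\<in>X \<inter> Pow ?A. pmf (edge_law \<mu> n w) E)"
      by (subst emeasure_measure_pmf_finite) simp_all
    finally show ?thesis .
  qed
  moreover have "(\<lambda>w. pmf (edge_law \<mu> n w) E) \<in> borel_measurable (\<Pi>\<^sub>M i\<in>{..<n}. M)" for E
    unfolding pmf_edge_law case_prod_unfold
    by (cases "E \<subseteq> ?A")
      (auto simp: vertex_pairs_def intro!: borel_measurable_prod bernoulli_conn_prob_measurable)
  ultimately show "(\<lambda>w. emeasure (measure_pmf (edge_law \<mu> n w)) X)
      \<in> borel_measurable (\<Pi>\<^sub>M i\<in>{..<n}. M)"
    by simp
qed (simp_all add: prob_space_imp_subprob_space measure_pmf.prob_space_axioms)

lemma prob_space_weights: "prob_space (\<Pi>\<^sub>M i\<in>I. M)"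
  by (intro prob_space_PiM prob_space_axioms)

lemma sets_random_graph [simp]: "sets (random_graph M n) = UNIV"
proof -
  interpret W: prob_space "\<Pi>\<^sub>M i\<in>{..<n}. M" by (rule prob_space_weights)
  show ?thesis
    unfolding random_graph_def
    by (subst sets_bind_measurable[OF edge_law_measurable W.not_empty]) simp
qed

lemma space_random_graph [simp]: "space (random_graph M n) = UNIV"
  using sets_eq_imp_space_eq[of "random_graph M n" "count_space UNIV"] by simp

lemma prob_space_random_graph: "prob_space (random_graph M n)"
proof -
  interpret W: prob_space "\<Pi>\<^sub>M i\<in>{..<n}. M" by (rule prob_space_weights)
  show ?thesis unfolding random_graph_def
    by (rule W.prob_space_bind[OF _ edge_law_measurable])
      (simp add: measure_pmf.prob_space_axioms)
qed

lemma prob_clique: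
  assumes supp: "AE h in M. 1 \<le> h" and S: "S \<subseteq> {..<n}" "card S = k"
  shows "measure (random_graph M n) {E. vertex_pairs S \<subseteq> E} = clique_prob M k n"
proof -
  let ?W = "\<lambda>I::nat set. \<Pi>\<^sub>M i\<in>I. M"
  let ?\<mu> = "mean M"
  let ?b = "\<lambda>x y. pmf (bernoulli_pmf (conn_prob ?\<mu> n x y)) True"
  interpret W: prob_space "?W {..<n}" by (rule prob_space_weights)
  interpret V: prob_space "?W {..<k}" by (rule prob_space_weights)
  have "finite S" using S finite_subset by blast
  obtain f where f: "bij_betw f {..<k} S" "strict_mono_on {..<k} f"
    using ex_bij_betw_strict_mono_card[OF \<open>finite S\<close>] S(2) by metis
  have inj: "inj_on f {..<k}" and img: "f ` {..<k} = S"
    using f(1) by (auto simp: bij_betw_def)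
  have less: "f i < f j \<longleftrightarrow> i < j" if "i < k" "j < k" for i j
    using strict_mono_on_less[OF f(2)] that by simp
  have "(\<lambda>(i, j). (f i, f j)) ` vertex_pairs {..<k} = vertex_pairs S"
    unfolding vertex_pairs_def img[symmetric] by (auto simp: less image_iff)
  moreover have "inj_on (\<lambda>(i, j). (f i, f j)) (vertex_pairs {..<k})"
    using inj by (auto simp: inj_on_def vertex_pairs_def)
  ultimately have bij: "bij_betw (\<lambda>(i, j). (f i, f j)) (vertex_pairs {..<k}) (vertex_pairs S)"
    by (simp add: bij_betw_def)
  have "measure (random_graph M n) {E. vertex_pairs S \<subseteq> E} =
      (\<integral>w. measure_pmf.prob (edge_law ?\<mu> n w) {E. vertex_pairs S \<subseteq> E} \<partial>?W {..<n})"
    unfolding random_graph_def by (rule W.measure_bind[OF edge_law_measurable]) simp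
  also have "\<dots> = (\<integral>w. (\<Prod>(i, j)\<in>vertex_pairs S. ?b (w i) (w j)) \<partial>?W {..<n})"
    by (simp add: prob_edge_law_superset[OF vertex_pairs_mono[OF S(1)]])
  also have "\<dots> = (\<integral>w. (\<Prod>(i, j)\<in>vertex_pairs {..<k}. ?b (w (f i)) (w (f j))) \<partial>?W {..<n})"
    by (subst prod.reindex_bij_betw[OF bij, symmetric]) (simp add: case_prod_unfold)
  also have "\<dots> = (\<integral>w. (\<Prod>(i, j)\<in>vertex_pairs {..<k}. ?b (w i) (w j))
      \<partial>distr (?W {..<n}) (?W {..<k}) (\<lambda>w. \<lambda>i\<in>{..<k}. w (f i)))"
  proof (subst integral_distr)
    show "(\<lambda>w. \<lambda>i\<in>{..<k}. w (f i)) \<in> ?W {..<n} \<rightarrow>\<^sub>M ?W {..<k}"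
      using img S by (intro measurable_restrict measurable_component_singleton) auto
    show "(\<lambda>w. \<Prod>(i, j)\<in>vertex_pairs {..<k}. ?b (w i) (w j)) \<in> borel_measurable (?W {..<k})"
      unfolding case_prod_unfold
      by (auto simp: vertex_pairs_def intro!: borel_measurable_prod bernoulli_conn_prob_measurable)
  qed (auto intro!: Bochner_Integration.integral_cong prod.cong simp: vertex_pairs_def)
  also have "distr (?W {..<n}) (?W {..<k}) (\<lambda>w. \<lambda>i\<in>{..<k}. w (f i)) = ?W {..<k}"
    using inj img S by (intro distr_PiM_reindex prob_space_axioms) auto
  also have "(\<integral>w. (\<Prod>(i, j)\<in>vertex_pairs {..<k}. ?b (w i) (w j)) \<partial>?W {..<k}) =
      clique_prob M k n"
    unfolding clique_prob_def
  proof (rule integral_cong_AE)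
    show "(\<lambda>w. \<Prod>(i, j)\<in>vertex_pairs {..<k}. ?b (w i) (w j)) \<in> borel_measurable (?W {..<k})"
      unfolding case_prod_unfold
      by (auto simp: vertex_pairs_def intro!: borel_measurable_prod bernoulli_conn_prob_measurable)
    show "(\<lambda>w. \<Prod>(i, j)\<in>vertex_pairs {..<k}. conn_prob ?\<mu> n (w i) (w j)) \<in>
        borel_measurable (?W {..<k})"
      unfolding case_prod_unfold
      by (auto simp: vertex_pairs_def intro!: borel_measurable_prod conn_prob_measurable
            borel_component)
    have "AE w in ?W {..<k}. \<forall>i\<in>{..<k}. 1 \<le> w i"
      using supp by (intro AE_finite_allI AE_PiM_component prob_space_axioms) auto
    then show "AE w in ?W {..<k}. (\<Prod>(i, j)\<in>vertex_pairs {..<k}. ?b (w i) (w j)) =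
        (\<Prod>(i, j)\<in>vertex_pairs {..<k}. conn_prob ?\<mu> n (w i) (w j))"
    proof eventually_elim
      case (elim w)
      have "0 \<le> ?\<mu>"
        using supp unfolding mean_def by (intro integral_nonneg_AE) auto
      have "0 \<le> conn_prob ?\<mu> n (w i) (w j)" if "i < k" "j < k" for i j
      proof -
        have "1 \<le> w i" "1 \<le> w j" using elim that by simp_all
        then show ?thesis using \<open>0 \<le> ?\<mu>\<close> by (simp add: conn_prob_def)
      qed
      moreover have "conn_prob ?\<mu> n x y \<le> 1" for x y
        by (simp add: conn_prob_def)
      ultimately show ?case
        by (auto simp: vertex_pairs_def pmf_bernoulli_clamp intro!: prod.cong)
    qed
  qed
  finally show ?thesis .
qed

theorem avg_cliques_eq:
  assumes "AE h in M. 1 \<le> h"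
  shows "avg_cliques M k n = real (n choose k) * clique_prob M k n"
proof -
  interpret G: prob_space "random_graph M n" by (rule prob_space_random_graph)
  let ?C = "{S. S \<subseteq> {..<n} \<and> card S = k}"
  have fin: "finite ?C" by simp
  have "real (card (cliques k n E)) =
      (\<Sum>S\<in>?C. indicat_real {E. vertex_pairs S \<subseteq> E} E)" for E
  proof -
    have "cliques k n E = {S \<in> ?C. vertex_pairs S \<subseteq> E}" by (auto simp: cliques_def)
    then show ?thesis using fin by (simp add: indicator_def sum.If_cases Int_def)
  qed
  then have "avg_cliques M k n =
      (\<integral>E. (\<Sum>S\<in>?C. indicat_real {E. vertex_pairs S \<subseteq> E} E) \<partial>random_graph M n)"
    by (simp add: avg_cliques_def)
  also have "\<dots> = (\<Sum>S\<in>?C. measure (random_graph M n) {E. vertex_pairs S \<subseteq> E})"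
    by (subst Bochner_Integration.integral_sum) (auto simp: G.emeasure_eq_measure)
  also have "\<dots> = real (card ?C) * clique_prob M k n"
    using prob_clique[OF assms] by simp
  also have "card ?C = n choose k"
    using n_subsets[of "{..<n}" k] by simp
  finally show ?thesis .
qed

end

end

theory Submission
  imports Defs
begin

text \<open>
  With \<open>y\<^sub>i = H\<^sub>i / sqrt (\<mu> n)\<close> the clique probability is the expectation of
  \<open>\<Prod>i<j. min (y\<^sub>i y\<^sub>j) 1\<close>. It is at least the probability that all \<open>y\<^sub>i\<close> exceed 1, which has the
  claimed order. For the upper bound, the product is dominated by \<open>\<Prod>i. min (y\<^sub>i\<^sup>a) (y\<^sub>i\<^sup>b)\<close> with
  \<open>a = 1 + b / 2\<close>. By independence it is enough to bound one factor, and since \<open>\<tau> < 3\<close> one can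
  choose \<open>1 < b < \<tau> - 1 < a\<close>, so that the mean of that factor is of the order of the tail at
  \<open>sqrt n\<close>.
\<close>

section \<open>Deterministic bound on the product over pairs\<close>

text \<open>
  The right-hand side is affine in \<open>b\<close> on \<open>{1..2}\<close>, so the cases \<open>b = 1\<close> and \<open>b = 2\<close> suffice.
\<close>

lemma clamped_triple_sum_le:
  fixes b u v w :: real
  assumes "1 \<le> b" "b \<le> 2"
  defines "G \<equiv> \<lambda>x. min ((1 + b / 2) * x) (b * x)"
  shows "min (u + v) 0 + min (u + w) 0 + min (v + w) 0 \<le> G u + G v + G w"
proof -
  let ?L = "min (u + v) 0 + min (u + w) 0 + min (v + w) 0"
  let ?G1 = "\<lambda>x::real. min (3 / 2 * x) x"
  have G: "G x = (2 - b) * ?G1 x + (b - 1) * (2 * x)" for x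
  proof (cases "0 \<le> x")
    case True
    have "b * x \<le> (1 + b / 2) * x"
      using assms True by (intro mult_right_mono) auto
    then show ?thesis using True by (simp add: G_def min_def field_simps)
  next
    case False
    have "(1 + b / 2) * x \<le> b * x"
      using assms False by (intro mult_right_mono_neg) auto
    then show ?thesis using False by (simp add: G_def min_def field_simps)
  qed
  \<comment> \<open>For every t in [0, 1], \<open>min x 0 \<le> t * x\<close>. Take t = 1 for two
    negative entries, t = 0 for two nonnegative ones, and for mixed pairs t = 1/2 or t = 3/4
    according to whether one or two of the three entries are nonnegative.\<close>
  have L1: "?L \<le> ?G1 u + ?G1 v + ?G1 w"
    by (simp add: min_def)
  have L2: "?L \<le> 2 * u + 2 * v + 2 * w"
    by (simp add: min_def)
  have "?L = (2 - b) * ?L + (b - 1) * ?L"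
    by (simp add: algebra_simps)
  also have "\<dots> \<le> (2 - b) * (?G1 u + ?G1 v + ?G1 w) + (b - 1) * (2 * u + 2 * v + 2 * w)"
    using assms by (intro add_mono mult_left_mono L1 L2) auto
  also have "\<dots> = G u + G v + G w"
    unfolding G by (simp add: algebra_simps)
  finally show ?thesis .
qed

text \<open>
  A set of \<open>n + 1\<close> elements is handled by averaging over its subsets with one element removed:
  each pair survives \<open>n - 1\<close> of the removals and each element \<open>n\<close> of them.
\<close>

lemma pair_sum_le_of_triples:
  fixes m :: "'a \<Rightarrow> 'a \<Rightarrow> real" and G :: "'a \<Rightarrow> real"
  assumes sym: "\<And>i j. m i j = m j i" and diag: "\<And>i. m i i = 0"
    and triple: "\<And>i j l. distinct [i, j, l] \<Longrightarrow> m i j + m i l + m j l \<le> G i + G j + G l"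
    and "card A = n" "3 \<le> n"
  shows "(\<Sum>i\<in>A. \<Sum>j\<in>A. m i j) \<le> (real n - 1) * (\<Sum>i\<in>A. G i)"
  using \<open>3 \<le> n\<close> \<open>card A = n\<close>
proof (induction n arbitrary: A rule: dec_induct)
  case base
  then obtain x y z where A: "A = {x, y, z}" "x \<noteq> y" "x \<noteq> z" "y \<noteq> z"
    by (auto simp: card_3_iff)
  \<comment> \<open>The double sum runs over ordered pairs; the factor 3 - 1 = 2 is exactly this
    double counting.\<close>
  show ?case
    using A triple[of x y z] sym[of y x] sym[of z x] sym[of z y] by (simp add: diag)
next
  case (step n)
  let ?W = "\<lambda>A. \<Sum>i\<in>A. \<Sum>j\<in>A. m i j"
  have fin: "finite A" using step by (metis card.infinite nat.distinct(1))
  have W: "?W (A - {v}) = ?W A - 2 * (\<Sum>j\<in>A. m v j)" if "v \<in> A" for v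
  proof -
    have "?W (A - {v}) = (\<Sum>i\<in>A - {v}. (\<Sum>j\<in>A. m i j) - m i v)"
      using fin that by (intro sum.cong) (auto simp: sum_diff1)
    also have "\<dots> = ?W A - (\<Sum>j\<in>A. m v j) - ((\<Sum>i\<in>A. m i v) - m v v)"
      using fin that by (simp add: sum_subtractf sum_diff1)
    finally show ?thesis using diag sym by simp
  qed
  have "(real n - 1) * ?W A = (\<Sum>v\<in>A. ?W (A - {v}))"
    using step.prems by (simp add: W sum_subtractf sum_distrib_left[symmetric] algebra_simps)
  also have "\<dots> \<le> (\<Sum>v\<in>A. (real n - 1) * (\<Sum>i\<in>A - {v}. G i))"
    using step fin by (intro sum_mono step.IH) auto
  also have "\<dots> = (real n - 1) * (real n * (\<Sum>i\<in>A. G i))"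
  proof -
    have "(\<Sum>v\<in>A. \<Sum>i\<in>A - {v}. G i) = (\<Sum>v\<in>A. (\<Sum>i\<in>A. G i) - G v)"
      using fin by (intro sum.cong) (auto simp: sum_diff1)
    also have "\<dots> = real n * (\<Sum>i\<in>A. G i)"
      using step.prems by (simp add: sum_subtractf algebra_simps)
    finally show ?thesis by (simp add: sum_distrib_left[symmetric])
  qed
  \<comment> \<open>As \<open>3 \<le> n\<close>, the common factor \<open>real n - 1\<close> is
    positive and cancels.\<close>
  finally show ?case using step.hyps by simp
qed

text \<open>Serves to pass from the edges, each recorded once, to the ordered double sum in which
  the averaging over subsets is carried out.\<close>

lemma sum_vertex_pairs_symmetric:
  fixes m :: "nat \<Rightarrow> nat \<Rightarrow> real"
  assumes sym: "\<And>i j. m i j = m j i" and diag: "\<And>i. m i i = 0"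
  shows "(\<Sum>i<k. \<Sum>j<k. m i j) = 2 * (\<Sum>(i, j)\<in>vertex_pairs {..<k}. m i j)"
proof (induction k)
  case 0
  show ?case by (simp add: vertex_pairs_def)
next
  case (Suc k)
  have "vertex_pairs {..<Suc k} = vertex_pairs {..<k} \<union> (\<lambda>i. (i, k)) ` {..<k}"
    by (auto simp: vertex_pairs_def less_Suc_eq)
  moreover have "vertex_pairs {..<k} \<inter> (\<lambda>i. (i, k)) ` {..<k} = {}"
    by (auto simp: vertex_pairs_def)
  ultimately have "(\<Sum>(i, j)\<in>vertex_pairs {..<Suc k}. m i j) =
      (\<Sum>(i, j)\<in>vertex_pairs {..<k}. m i j) + (\<Sum>(i, j)\<in>(\<lambda>i. (i, k)) ` {..<k}. m i j)"
    using sum.union_disjoint[of "vertex_pairs {..<k}" "(\<lambda>i. (i, k)) ` {..<k}" "\<lambda>(i, j). m i j"]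
    by simp
  also have "(\<Sum>(i, j)\<in>(\<lambda>i. (i, k)) ` {..<k}. m i j) = (\<Sum>i<k. m i k)"
    by (subst sum.reindex) (auto simp: inj_on_def)
  finally show ?case
    using Suc by (simp add: sum.distrib diag sym[of k])
qed

text \<open>Logarithms turn the clamped products into clamped sums, to which the averaged triple
  inequality applies. Because \<open>b \<le> 2\<close>, the factor on the right is
  \<open>y i powr (1 + b / 2)\<close> for \<open>y i \<le> 1\<close> and \<open>y i powr b\<close>
  beyond.\<close>

lemma pair_product_le:
  fixes y :: "nat \<Rightarrow> real"
  assumes "1 \<le> b" "b \<le> 2" "3 \<le> k" and y: "\<And>i. i < k \<Longrightarrow> 0 < y i"
  shows "(\<Prod>(i, j)\<in>vertex_pairs {..<k}. min (y i * y j) 1) \<le>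
           (\<Prod>i<k. min (y i powr (1 + b / 2)) (y i powr b))"
proof -
  let ?u = "\<lambda>i. ln (y i)"
  let ?G = "\<lambda>x. min ((1 + b / 2) * x) (b * x)"
  define m where "m i j = (if i = j then 0 else min (?u i + ?u j) 0)" for i j
  let ?S = "\<Sum>(i, j)\<in>vertex_pairs {..<k}. m i j"
  let ?T = "\<Sum>i<k. ?G (?u i)"
  have S0: "?S \<le> 0"
    by (intro sum_nonpos) (auto simp: m_def)
  have le: "(\<Sum>i<k. \<Sum>j<k. m i j) \<le> (real k - 1) * ?T"
  proof (rule pair_sum_le_of_triples)
    show "m i j + m i l + m j l \<le> ?G (?u i) + ?G (?u j) + ?G (?u l)" if "distinct [i, j, l]" for i j l
      using clamped_triple_sum_le[OF assms(1,2), of "?u i" "?u j" "?u l"] that by (simp add: m_def)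
  qed (use assms in \<open>auto simp: m_def add.commute\<close>)
  moreover have "(\<Sum>i<k. \<Sum>j<k. m i j) = 2 * ?S"
    by (intro sum_vertex_pairs_symmetric) (auto simp: m_def add.commute)
  ultimately have *: "2 * ?S \<le> (real k - 1) * ?T"
    by simp
  \<comment> \<open>Averaging leaves the factor (k - 1) / 2, which is at least 1, in front of
    \<open>?T\<close>. Dropping it only weakens the bound when \<open>?T\<close> is negative;
    otherwise the sign of \<open>?S\<close> suffices.\<close>
  have "?S \<le> ?T"
  proof (cases "0 \<le> ?T")
    case True
    then show ?thesis using S0 by linarith
  next
    case False
    then have "(real k - 1) * ?T \<le> 2 * ?T"
      using \<open>3 \<le> k\<close> by (intro mult_right_mono_neg) auto
    then show ?thesis using * by linarith
  qed
  have "min (y i * y j) 1 = exp (m i j)" if "(i, j) \<in> vertex_pairs {..<k}" for i j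
  proof -
    have ij: "0 < y i" "0 < y j" "i \<noteq> j" using that y by (auto simp: vertex_pairs_def)
    then have "exp (ln (y i) + ln (y j)) = y i * y j" by (simp add: exp_add)
    then show ?thesis using ij unfolding m_def min_def by (metis exp_le_cancel_iff exp_zero)
  qed
  then have "(\<Prod>(i, j)\<in>vertex_pairs {..<k}. min (y i * y j) 1) = exp ?S"
    by (auto simp: exp_sum case_prod_unfold intro!: prod.cong)
  also have "\<dots> \<le> exp ?T"
    using \<open>?S \<le> ?T\<close> by simp
  also have "\<dots> = (\<Prod>i<k. min (y i powr (1 + b / 2)) (y i powr b))"
    unfolding exp_sum[OF finite_lessThan]
  proof (intro prod.cong refl)
    fix i assume "i \<in> {..<k}"
    then have "0 < y i" using y by simp
    then show "exp (?G (?u i)) = min (y i powr (1 + b / 2)) (y i powr b)"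
      by (auto simp: powr_def min_def)
  qed
  finally show ?thesis .
qed

section \<open>Moments of the weight on either side of a threshold\<close>

context real_distribution
begin

lemma tail_antimono: "x \<le> y \<Longrightarrow> tail M y \<le> tail M x"
  unfolding tail_def by (intro finite_measure_mono) auto

lemma tail_nonneg: "0 \<le> tail M x"
  by (simp add: tail_def)

text \<open>
  Doubling \<open>s\<close> multiplies the quotient of the truncated moment and the tail by at most
  \<open>K / 2\<^sup>a < 1\<close>, up to a bounded additive term.
\<close>

lemma truncated_moment_le_tail:
  assumes "0 < x\<^sub>0" "0 < a" and pos: "\<And>s. x\<^sub>0 \<le> s \<Longrightarrow> 0 < tail M s"
    and dbl: "\<And>s. x\<^sub>0 \<le> s \<Longrightarrow> tail M s \<le> K * tail M (2 * s)" and K: "K < 2 powr a"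
  shows "\<exists>C. \<forall>s\<ge>x\<^sub>0. (\<integral>h. indicator {0<..s} h * (h / s) powr a \<partial>M) \<le> C * tail M s"
proof -
  let ?f = "\<lambda>s h. indicator {0<..s} h * (h / s) powr a"
  define \<theta> where "\<theta> = K / 2 powr a"
  \<comment> \<open>The first entry covers \<open>s \<le> 2 * x\<^sub>0\<close>, where the moment is
    at most 1; the second makes \<open>\<theta> * C + K \<le> C\<close>, so that the bound survives
    a doubling.\<close>
  define C where "C = max (1 / tail M (2 * x\<^sub>0)) (K / (1 - \<theta>))"
  have th: "\<theta> < 1" using K by (simp add: \<theta>_def)
  have f01: "0 \<le> ?f s h" "?f s h \<le> 1" if "0 < s" for s h
    using that powr_mono2[of a "h / s" 1] \<open>0 < a\<close> by (auto simp: indicator_def)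
  have int: "integrable M (?f s)" if "0 < s" for s
    by (rule integrable_const_bound[of _ 1]) (use f01[OF that] in auto)
  have base: "integral\<^sup>L M (?f s) \<le> C * tail M s" if "x\<^sub>0 \<le> s" "s \<le> 2 * x\<^sub>0" for s
  proof -
    have s: "0 < s" using that assms by simp
    have "integral\<^sup>L M (?f s) \<le> 1"
      using f01[OF s] by (intro integral_le_const int[OF s]) auto
    also have "\<dots> = 1 / tail M (2 * x\<^sub>0) * tail M (2 * x\<^sub>0)"
      using pos[of "2 * x\<^sub>0"] assms(1) by simp
    also have "\<dots> \<le> C * tail M s"
      using tail_antimono[OF that(2)] pos[of "2 * x\<^sub>0"] assms
      by (intro mult_mono) (auto simp: C_def tail_nonneg le_max_iff_disj)
    finally show ?thesis .
  qed
  have "x\<^sub>0 \<le> s \<Longrightarrow> s < 2 ^ n * x\<^sub>0 \<Longrightarrow> integral\<^sup>L M (?f s) \<le> C * tail M s" for n s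
  proof (induction n arbitrary: s)
    case 0
    then show ?case by simp
  next
    case (Suc n)
    show ?case
    proof (cases "s \<le> 2 * x\<^sub>0")
      case True
      then show ?thesis using base Suc.prems by simp
    next
      case False
      let ?t = "s / 2"
      have t: "x\<^sub>0 \<le> ?t" "0 < ?t" "0 < s" using False assms by auto
      \<comment> \<open>Cut at \<open>?t\<close>: below it, rescaling from \<open>s\<close> to
        \<open>?t\<close> costs \<open>2 powr - a\<close>; between \<open>?t\<close> and
        \<open>s\<close> the integrand is at most 1.\<close>
      have "?f s h \<le> 2 powr - a * ?f ?t h + indicator {?t<..} h" for h
      proof -
        have "(h / s) powr a = 2 powr - a * (h / ?t) powr a" if "0 < h"
          using that t powr_mult[of "1 / 2" "h / ?t" a] by (simp add: powr_minus powr_divide field_simps)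
        moreover have "(h / s) powr a \<le> 1" if "0 < h" "h \<le> s"
          using powr_mono2[of a "h / s" 1] that t \<open>0 < a\<close> by simp
        ultimately show ?thesis using t by (auto simp: indicator_def)
      qed
      then have "integral\<^sup>L M (?f s) \<le> (\<integral>h. 2 powr - a * ?f ?t h + indicator {?t<..} h \<partial>M)"
        using t by (intro integral_mono int Bochner_Integration.integrable_add integrable_mult_right)
          (auto intro: int simp: emeasure_eq_measure)
      also have "\<dots> = 2 powr - a * integral\<^sup>L M (?f ?t) + tail M ?t"
        using int[OF t(2)] by (subst Bochner_Integration.integral_add) (auto simp: tail_def emeasure_eq_measure)
      also have "\<dots> \<le> 2 powr - a * (C * tail M ?t) + tail M ?t"
        using Suc.IH[of ?t] Suc.prems t by (intro add_mono mult_left_mono) auto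
      also have "\<dots> = (2 powr - a * C + 1) * tail M ?t"
        by (simp add: algebra_simps)
      also have "\<dots> \<le> (2 powr - a * C + 1) * (K * tail M s)"
      proof (intro mult_left_mono)
        show "tail M ?t \<le> K * tail M s" using dbl[OF t(1)] by simp
        have "0 \<le> C" by (simp add: C_def tail_nonneg le_max_iff_disj)
        then show "0 \<le> 2 powr - a * C + 1" by simp
      qed
      also have "\<dots> = (\<theta> * C + K) * tail M s"
        by (simp add: \<theta>_def powr_minus field_simps)
      also have "\<dots> \<le> C * tail M s"
      proof (intro mult_right_mono tail_nonneg)
        have "K / (1 - \<theta>) \<le> C" by (simp add: C_def)
        then show "\<theta> * C + K \<le> C" using th by (simp add: field_simps)
      qed
      finally show ?thesis .
    qed
  qed
  moreover have "\<exists>n. s < 2 ^ n * x\<^sub>0" for s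
    using real_arch_pow[of 2 "s / x\<^sub>0"] \<open>0 < x\<^sub>0\<close> by (simp add: field_simps)
  ultimately show ?thesis by blast
qed

text \<open>Cutting at \<open>2 * s\<close> bounds the moment by \<open>2 powr b\<close> times the
  tail plus \<open>2 powr b\<close> times the moment at \<open>2 * s\<close>. Iteration yields a
  geometric series of ratio \<open>2 powr b * K\<close>. A cutoff \<open>m\<close> keeps all
  integrals finite and is removed by monotone convergence, which also gives integrability.\<close>

lemma tail_moment_le_tail:
  assumes "0 < x\<^sub>0" "0 < b"
    and dbl: "\<And>s. x\<^sub>0 \<le> s \<Longrightarrow> tail M (2 * s) \<le> K * tail M s" and K: "2 powr b * K < 1"
  shows "\<exists>C. \<forall>s\<ge>x\<^sub>0. integrable M (\<lambda>h. indicator {s<..} h * (h / s) powr b) \<and>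
           (\<integral>h. indicator {s<..} h * (h / s) powr b \<partial>M) \<le> C * tail M s"
proof -
  let ?f = "\<lambda>m s h. indicator {s<..m} h * (h / s) powr b :: real"
  \<comment> \<open>The sum of the geometric series, that is, the fixed point of the
    recursion.\<close>
  define C where "C = 2 powr b / (1 - 2 powr b * K)"
  have C0: "0 \<le> C" using K by (simp add: C_def)
  have C: "2 powr b + 2 powr b * K * C = C"
    using K by (simp add: C_def field_simps)
  have int: "integrable M (?f m s)" if "0 < s" for m s
  proof (rule integrable_const_bound)
    show "AE h in M. norm (?f m s h) \<le> (\<bar>m\<bar> / s) powr b"
      using that \<open>0 < b\<close> by (auto simp: indicator_def intro!: powr_mono2 divide_right_mono)
  qed auto
  \<comment> \<open>Here \<open>n\<close> bounds the number of doublings from \<open>s\<close> to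
    the cutoff; for \<open>n = 0\<close> the interval is empty. The constant depends on neither
    \<open>m\<close> nor \<open>n\<close>, as the limit in \<open>m\<close> requires.\<close>
  have trunc: "x\<^sub>0 \<le> s \<Longrightarrow> m \<le> 2 ^ n * s \<Longrightarrow> integral\<^sup>L M (?f m s) \<le> C * tail M s" for n m s
  proof (induction n arbitrary: s)
    case 0
    then have "?f m s = (\<lambda>_. 0)" by (auto simp: indicator_def)
    then show ?case using C0 by (simp add: tail_nonneg)
  next
    case (Suc n)
    have s: "0 < s" using Suc.prems assms by simp
    have "?f m s h \<le> 2 powr b * indicator {s<..} h + 2 powr b * ?f m (2 * s) h" for h
    proof -
      have "(h / s) powr b = 2 powr b * (h / (2 * s)) powr b" if "0 < h"
        using that s powr_mult[of 2 "h / (2 * s)" b] by simp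
      moreover have "(h / s) powr b \<le> 2 powr b" if "s < h" "h \<le> 2 * s"
        using that s \<open>0 < b\<close> by (intro powr_mono2) (auto simp: field_simps)
      ultimately show ?thesis using s by (auto simp: indicator_def)
    qed
    then have "integral\<^sup>L M (?f m s) \<le>
        (\<integral>h. 2 powr b * indicator {s<..} h + 2 powr b * ?f m (2 * s) h \<partial>M)"
      using s by (intro integral_mono int Bochner_Integration.integrable_add integrable_mult_right)
        (auto simp: emeasure_eq_measure)
    also have "\<dots> = 2 powr b * tail M s + 2 powr b * integral\<^sup>L M (?f m (2 * s))"
      using int[of "2 * s" m] s
      by (subst Bochner_Integration.integral_add) (auto simp: tail_def emeasure_eq_measure)
    also have "\<dots> \<le> 2 powr b * tail M s + 2 powr b * (C * tail M (2 * s))"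
      using Suc.IH[of "2 * s"] Suc.prems s
      by (intro add_mono mult_left_mono) (auto simp: mult_ac)
    also have "\<dots> \<le> 2 powr b * tail M s + 2 powr b * (C * (K * tail M s))"
      using dbl[OF Suc.prems(1)] C0 by (intro add_mono mult_left_mono) auto
    also have "\<dots> = (2 powr b + 2 powr b * K * C) * tail M s"
      by (simp add: algebra_simps)
    finally show ?case by (simp only: C)
  qed
  have "integrable M (\<lambda>h. indicator {s<..} h * (h / s) powr b) \<and>
           (\<integral>h. indicator {s<..} h * (h / s) powr b \<partial>M) \<le> C * tail M s" if s: "x\<^sub>0 \<le> s" for s
  proof -
    let ?g = "\<lambda>h. indicator {s<..} h * (h / s) powr b :: real"
    have s0: "0 < s" using s assms by simp
    have le: "integral\<^sup>L M (?f (real m) s) \<le> C * tail M s" for m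
    proof -
      obtain n where "real m / s < 2 ^ n" using real_arch_pow[of 2 "real m / s"] by auto
      then show ?thesis using s s0 by (intro trunc[of s _ n]) (auto simp: field_simps)
    qed
    have mono: "?f (real m) s h \<le> ?f (real m') s h" if "m \<le> m'" for m m' h
      using that by (auto simp: indicator_def)
    have "incseq (\<lambda>m. integral\<^sup>L M (?f (real m) s))"
      by (intro incseq_SucI integral_mono int s0 mono) auto
    then obtain L where L: "(\<lambda>m. integral\<^sup>L M (?f (real m) s)) \<longlonglongrightarrow> L"
      using incseq_convergent[of _ "C * tail M s"] le by blast
    have lim: "(\<lambda>m. ?f (real m) s h) \<longlonglongrightarrow> ?g h" for h
    proof (rule tendsto_eventually)
      show "\<forall>\<^sub>F m in sequentially. ?f (real m) s h = ?g h"
        using eventually_ge_at_top[of "nat \<lceil>h\<rceil>"]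
        by eventually_elim (auto simp: indicator_def ceiling_le_iff nat_le_iff)
    qed
    note * = int[OF s0] _ _ L
    have "integrable M ?g" "integral\<^sup>L M ?g = L"
      by (rule integrable_monotone_convergence[OF *] integral_monotone_convergence[OF *],
          use lim in \<open>auto simp: incseq_def intro!: mono\<close>)+
    moreover have "L \<le> C * tail M s"
      using L le by (intro LIMSEQ_le_const2) auto
    ultimately show ?thesis by simp
  qed
  then show ?thesis by blast
qed

text \<open>The limit \<open>2 powr - \<alpha>\<close> lies strictly between
  \<open>2 powr - a\<close> and \<open>2 powr - b\<close>, hence so does the ratio from some point
  on.\<close>

lemma regularly_varying_tail_doubling:
  assumes rv: "((\<lambda>h. tail M (2 * h) / tail M h) \<longlongrightarrow> 2 powr - \<alpha>) at_top"
    and "b < \<alpha>" "\<alpha> < a"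
  shows "\<forall>\<^sub>F s in at_top. 0 < tail M s \<and> tail M s \<le> 2 powr a * tail M (2 * s) \<and>
           tail M (2 * s) \<le> 2 powr - b * tail M s"
proof -
  have "\<forall>\<^sub>F s in at_top. 2 powr - a < tail M (2 * s) / tail M s"
    "\<forall>\<^sub>F s in at_top. tail M (2 * s) / tail M s < 2 powr - b"
    using assms by (auto intro!: order_tendstoD[OF rv])
  then show ?thesis
  proof eventually_elim
    case (elim s)
    have "0 < tail M (2 * s) / tail M s"
      using elim(1) by (rule less_trans[rotated]) simp
    \<comment> \<open>Division by zero gives 0, so a positive ratio excludes a vanishing
      denominator.\<close>
    then have "0 < tail M s"
      using tail_nonneg[of s] by (cases "tail M s = 0") auto
    with elim show ?case by (simp add: powr_minus field_simps)
  qed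
qed

text \<open>The power \<open>a\<close> is integrated below \<open>s\<close> and the power
  \<open>b\<close> above it; each part is of the order of the tail because \<alpha> lies strictly
  between \<open>b\<close> and \<open>a\<close>. The part above \<open>s\<close> also controls the
  first moment, as \<open>1 \<le> b\<close>.\<close>

lemma weight_moment_le_tail:
  assumes supp: "AE h in M. 1 \<le> h"
    and rv: "((\<lambda>h. tail M (2 * h) / tail M h) \<longlongrightarrow> 2 powr - \<alpha>) at_top"
    and ab: "1 \<le> b" "b < \<alpha>" "\<alpha> < a"
  shows "\<exists>C x\<^sub>0. 0 < x\<^sub>0 \<and> (\<forall>s\<ge>x\<^sub>0. 0 < tail M s \<and>
           integrable M (\<lambda>h. min ((h / s) powr a) ((h / s) powr b)) \<and>
           (\<integral>h. min ((h / s) powr a) ((h / s) powr b) \<partial>M) \<le> C * tail M s)"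
    and "integrable M (\<lambda>h. h)"
proof -
  \<comment> \<open>Doubling bounds with these intermediate exponents make both recursions strict
    contractions: \<open>2 powr a' < 2 powr a\<close> and
    \<open>2 powr b * 2 powr - b' < 1\<close>.\<close>
  obtain a' b' where ab': "b < b'" "b' < \<alpha>" "\<alpha> < a'" "a' < a"
    using ab dense by metis
  obtain x\<^sub>1 where x1: "\<And>s. x\<^sub>1 \<le> s \<Longrightarrow> 0 < tail M s \<and> tail M s \<le> 2 powr a' * tail M (2 * s) \<and>
           tail M (2 * s) \<le> 2 powr - b' * tail M s"
    using regularly_varying_tail_doubling[OF rv ab'(2,3)] by (auto simp: eventually_at_top_linorder)
  define x\<^sub>0 where "x\<^sub>0 = max x\<^sub>1 1"
  have x0: "0 < x\<^sub>0" "x\<^sub>1 \<le> x\<^sub>0" by (auto simp: x\<^sub>0_def)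
  let ?f = "\<lambda>s h. indicator {0<..s} h * (h / s) powr a :: real"
  let ?g = "\<lambda>s h. indicator {s<..} h * (h / s) powr b :: real"
  let ?m = "\<lambda>s h. min ((h / s) powr a) ((h / s) powr b)"
  obtain C1 where C1: "\<And>s. x\<^sub>0 \<le> s \<Longrightarrow> integral\<^sup>L M (?f s) \<le> C1 * tail M s"
    using truncated_moment_le_tail[of x\<^sub>0 a "2 powr a'"] x0 x1 ab ab' by auto
  have "2 powr b * 2 powr - b' < (1 :: real)"
    using ab' powr_less_mono[of "b - b'" 0 2] by (simp flip: powr_add)
  then obtain C2 where g: "\<And>s. x\<^sub>0 \<le> s \<Longrightarrow> integrable M (?g s)"
    and C2: "\<And>s. x\<^sub>0 \<le> s \<Longrightarrow> integral\<^sup>L M (?g s) \<le> C2 * tail M s"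
    using tail_moment_le_tail[of x\<^sub>0 b "2 powr - b'"] x0 x1 ab by auto
  have "0 < tail M s \<and> integrable M (?m s) \<and> integral\<^sup>L M (?m s) \<le> (C1 + C2) * tail M s"
    if "x\<^sub>0 \<le> s" for s
  proof -
    have s: "0 < s" using that x0 by simp
    have f: "integrable M (?f s)"
      by (rule integrable_const_bound[of _ 1])
        (use s ab powr_mono2[of a "_ / s" 1] in \<open>auto simp: indicator_def\<close>)
    have fg: "integrable M (\<lambda>h. ?f s h + ?g s h)"
      by (intro Bochner_Integration.integrable_add f g that)
    have le: "AE h in M. ?m s h \<le> ?f s h + ?g s h"
      using supp by eventually_elim (auto simp: indicator_def)
    have m: "integrable M (?m s)"
      by (rule Bochner_Integration.integrable_bound[OF fg]) (use le in \<open>auto elim!: eventually_mono\<close>)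
    have "integral\<^sup>L M (?m s) \<le> integral\<^sup>L M (?f s) + integral\<^sup>L M (?g s)"
      using integral_mono_AE[OF m fg le] f g[OF that] by simp
    also have "\<dots> \<le> (C1 + C2) * tail M s"
      using C1[OF that] C2[OF that] by (simp add: distrib_right)
    finally show ?thesis using m x1[of s] x0 that by simp
  qed
  then show "\<exists>C x\<^sub>0. 0 < x\<^sub>0 \<and> (\<forall>s\<ge>x\<^sub>0. 0 < tail M s \<and>
           integrable M (?m s) \<and> integral\<^sup>L M (?m s) \<le> C * tail M s)"
    using x0 by blast
  show "integrable M (\<lambda>h. h)"
  proof (rule Bochner_Integration.integrable_bound)
    show "integrable M (\<lambda>h. x\<^sub>0 + x\<^sub>0 * ?g x\<^sub>0 h)"
      by (intro Bochner_Integration.integrable_add integrable_mult_right g) auto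
    show "AE h in M. norm h \<le> norm (x\<^sub>0 + x\<^sub>0 * ?g x\<^sub>0 h)"
      using supp
    proof eventually_elim
      case (elim h)
      have "h \<le> x\<^sub>0 * (h / x\<^sub>0) powr b" if "x\<^sub>0 < h"
        using powr_mono[of 1 b "h / x\<^sub>0"] that x0 ab by (simp add: field_simps)
      then show ?case using elim x0 by (auto simp: indicator_def)
    qed
  qed simp
qed

section \<open>Two-sided bounds on the clique probability\<close>

lemma integrable_one_le_mean:
  assumes "AE h in M. 1 \<le> h" "integrable M (\<lambda>h. h)"
  shows "1 \<le> mean M"
  unfolding mean_def using assms by (intro integral_ge_const)

lemma AE_weights_ge_1:
  assumes "AE h in M. 1 \<le> h" "finite I"
  shows "AE w in (\<Pi>\<^sub>M i\<in>I. M). \<forall>i\<in>I. 1 \<le> w i"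
  using assms by (intro AE_finite_allI AE_PiM_component prob_space_axioms) auto

lemma clique_product_measurable:
  "(\<lambda>w. \<Prod>(i, j)\<in>vertex_pairs {..<k}. conn_prob \<mu> n (w i) (w j)) \<in>
     borel_measurable (\<Pi>\<^sub>M i\<in>{..<k}. M)"
  unfolding case_prod_unfold
  by (auto simp: vertex_pairs_def intro!: borel_measurable_prod conn_prob_measurable
        borel_component)

lemma integrable_clique_product:
  assumes supp: "AE h in M. 1 \<le> h" and "0 \<le> \<mu>"
  shows "integrable (\<Pi>\<^sub>M i\<in>{..<k}. M) (\<lambda>w. \<Prod>(i, j)\<in>vertex_pairs {..<k}. conn_prob \<mu> n (w i) (w j))"
proof -
  interpret W: prob_space "\<Pi>\<^sub>M i\<in>{..<k}. M" by (rule prob_space_weights)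
  have "AE w in (\<Pi>\<^sub>M i\<in>{..<k}. M).
      norm (\<Prod>(i, j)\<in>vertex_pairs {..<k}. conn_prob \<mu> n (w i) (w j)) \<le> 1"
    using AE_weights_ge_1[OF supp finite_lessThan[of k]]
  proof eventually_elim
    case w: (elim w)
    have "0 \<le> conn_prob \<mu> n (w i) (w j)" if "i < k" "j < k" for i j
    proof -
      have "1 \<le> w i" "1 \<le> w j" using w that by auto
      then show ?thesis using \<open>0 \<le> \<mu>\<close> by (simp add: conn_prob_def)
    qed
    then show ?case
      unfolding real_norm_def abs_prod by (intro prod_le_1) (auto simp: vertex_pairs_def conn_prob_def)
  qed
  then show ?thesis
    by (intro W.integrable_const_bound[of _ 1] clique_product_measurable)
qed

text \<open>If all weights exceed the square root of \<open>mean M * real n\<close>, every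
  connection probability is 1. The probability of this event is a power of the tail by
  independence.\<close>

lemma tail_power_le_clique_prob:
  assumes supp: "AE h in M. 1 \<le> h" and "0 < mean M" "0 < n"
  shows "tail M (sqrt (mean M * real n)) ^ k \<le> clique_prob M k n"
proof -
  interpret P: product_sigma_finite "\<lambda>_. M" ..
  let ?s = "sqrt (mean M * real n)"
  have s: "0 < ?s" "?s * ?s = mean M * real n" using assms by auto
  have int: "integrable M (indicator {?s<..} :: real \<Rightarrow> real)"
    by (simp add: emeasure_eq_measure)
  have "tail M ?s ^ k = (\<integral>w. (\<Prod>i<k. indicator {?s<..} (w i)) \<partial>(\<Pi>\<^sub>M i\<in>{..<k}. M))"
    using int by (subst P.product_integral_prod) (auto simp: tail_def)
  also have "\<dots> \<le> clique_prob M k n"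
    unfolding clique_prob_def
  proof (rule integral_mono_AE)
    show "integrable (\<Pi>\<^sub>M i\<in>{..<k}. M) (\<lambda>w. \<Prod>i<k. indicator {?s<..} (w i) :: real)"
      using int by (intro P.product_integrable_prod) auto
    show "AE w in (\<Pi>\<^sub>M i\<in>{..<k}. M). (\<Prod>i<k. indicator {?s<..} (w i)) \<le>
        (\<Prod>(i, j)\<in>vertex_pairs {..<k}. conn_prob (mean M) n (w i) (w j))"
      using AE_weights_ge_1[OF supp finite_lessThan[of k]]
    proof eventually_elim
      case w: (elim w)
      show "(\<Prod>i<k. indicator {?s<..} (w i)) \<le>
          (\<Prod>(i, j)\<in>vertex_pairs {..<k}. conn_prob (mean M) n (w i) (w j))"
      proof (cases "\<forall>i<k. ?s < w i")
        case True
        have "conn_prob (mean M) n (w i) (w j) = 1" if "i < k" "j < k" for i j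
        proof -
          have "?s * ?s \<le> w i * w j"
            using True that s(1) by (intro mult_mono) (auto simp: less_imp_le intro: order_trans[of 0 ?s])
          then show ?thesis using s(2) assms by (simp add: conn_prob_def)
        qed
        then have "(\<Prod>(i, j)\<in>vertex_pairs {..<k}. conn_prob (mean M) n (w i) (w j)) = 1"
          by (intro prod.neutral) (auto simp: vertex_pairs_def)
        then show ?thesis by (simp add: prod_le_1)
      next
        case False
        then have "(\<Prod>i<k. indicator {?s<..} (w i)) = (0 :: real)"
          by (auto simp: indicator_def)
        moreover have "0 \<le> conn_prob (mean M) n (w i) (w j)" if "i < k" "j < k" for i j
        proof -
          have "1 \<le> w i" "1 \<le> w j" using w that by auto
          then show ?thesis using assms by (simp add: conn_prob_def)
        qed
        then have "0 \<le> (\<Prod>(i, j)\<in>vertex_pairs {..<k}. conn_prob (mean M) n (w i) (w j))"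
          by (intro prod_nonneg) (auto simp: vertex_pairs_def)
        ultimately show ?thesis by (simp only:)
      qed
    qed
  qed (use assms in \<open>auto intro: integrable_clique_product\<close>)
  finally show ?thesis .
qed

text \<open>After rescaling the weights, \<open>pair_product_le\<close> dominates the integrand by a
  product of functions of one weight each, whose integral factorises by independence.\<close>

lemma clique_prob_le_weight_moment_power:
  assumes supp: "AE h in M. 1 \<le> h" and "0 < mean M" "0 < n"
    and "1 \<le> b" "b \<le> 2" "3 \<le> k"
  defines "g \<equiv> \<lambda>h. min ((h / sqrt (mean M * real n)) powr (1 + b / 2))
                      ((h / sqrt (mean M * real n)) powr b)"
  assumes g: "integrable M g"
  shows "clique_prob M k n \<le> (\<integral>h. g h \<partial>M) ^ k"
proof -
  interpret P: product_sigma_finite "\<lambda>_. M" ..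
  let ?s = "sqrt (mean M * real n)"
  have s: "0 < ?s" "?s * ?s = mean M * real n" using assms by auto
  have "clique_prob M k n \<le> (\<integral>w. (\<Prod>i<k. g (w i)) \<partial>(\<Pi>\<^sub>M i\<in>{..<k}. M))"
    unfolding clique_prob_def
  proof (rule integral_mono_AE)
    show "integrable (\<Pi>\<^sub>M i\<in>{..<k}. M) (\<lambda>w. \<Prod>i<k. g (w i))"
      using g by (intro P.product_integrable_prod) auto
    show "AE w in (\<Pi>\<^sub>M i\<in>{..<k}. M).
        (\<Prod>(i, j)\<in>vertex_pairs {..<k}. conn_prob (mean M) n (w i) (w j)) \<le> (\<Prod>i<k. g (w i))"
      using AE_weights_ge_1[OF supp finite_lessThan[of k]]
    proof eventually_elim
      case w: (elim w)
      have "conn_prob (mean M) n (w i) (w j) = min (w i / ?s * (w j / ?s)) 1" for i j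
        using s(2) by (simp add: conn_prob_def)
      moreover have "(\<Prod>(i, j)\<in>vertex_pairs {..<k}. min (w i / ?s * (w j / ?s)) 1) \<le>
          (\<Prod>i<k. g (w i))"
        unfolding g_def
      proof (rule pair_product_le)
        show "0 < w i / ?s" if "i < k" for i
        proof -
          have "1 \<le> w i" using w that by auto
          then show ?thesis using s(1) by (intro divide_pos_pos) auto
        qed
      qed fact+
      ultimately show "(\<Prod>(i, j)\<in>vertex_pairs {..<k}. conn_prob (mean M) n (w i) (w j)) \<le>
          (\<Prod>i<k. g (w i))" by simp
    qed
  qed (use assms in \<open>auto intro: integrable_clique_product\<close>)
  also have "\<dots> = (\<integral>h. g h \<partial>M) ^ k"
    using g by (subst P.product_integral_prod) auto
  finally show ?thesis .
qed

end

section \<open>Regular variation and the final asymptotics\<close>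

lemma tail_ratio_tendsto:
  assumes "slowly_varying l" and tail: "\<And>h. 1 \<le> h \<Longrightarrow> tail D h = l h * h powr p" and "0 < c"
  shows "((\<lambda>h. tail D (c * h) / tail D h) \<longlongrightarrow> c powr p) at_top"
proof (rule Lim_transform_eventually)
  show "((\<lambda>h. l (c * h) / l h * c powr p) \<longlongrightarrow> c powr p) at_top"
    using assms tendsto_mult[of "\<lambda>h. l (c * h) / l h" 1 at_top "\<lambda>_. c powr p"]
    by (auto simp: slowly_varying_def)
  show "\<forall>\<^sub>F h in at_top. l (c * h) / l h * c powr p = tail D (c * h) / tail D h"
    \<comment> \<open>The formula for the tail is available from 1 on, so both \<open>h\<close> and
      \<open>c * h\<close> have to be at least 1.\<close>
    using eventually_ge_at_top[of 1] eventually_ge_at_top[of "1 / c"]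
  proof eventually_elim
    case (elim h)
    then have "1 \<le> c * h" using \<open>0 < c\<close> by (simp add: field_simps)
    then show ?case using elim \<open>0 < c\<close> by (simp add: tail powr_mult)
  qed
qed

lemma same_orderI:
  assumes "0 < C1" and ev: "\<forall>\<^sub>F n in sequentially. C1 \<le> f n / g n \<and> f n / g n \<le> C2"
  shows "f \<asymp> g"
  unfolding same_order_def
proof (intro exI conjI)
  show "ereal C1 \<le> liminf (\<lambda>n. ereal (f n / g n))"
    by (rule Liminf_bounded) (use ev in \<open>auto elim: eventually_mono\<close>)
  show "limsup (\<lambda>n. ereal (f n / g n)) \<le> ereal C2"
    by (rule Limsup_bounded) (use ev in \<open>auto elim: eventually_mono\<close>)
  show "liminf (\<lambda>n. ereal (f n / g n)) \<le> limsup (\<lambda>n. ereal (f n / g n))"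
    by (rule Liminf_le_Limsup) simp
qed fact

theorem theorem2p1:
  fixes D :: "real measure" and l :: "real \<Rightarrow> real" and \<tau> :: real and k :: nat
  assumes "real_distribution D"
    and "AE h in D. 1 \<le> h"
    and "2 < \<tau>" and "\<tau> < 3"
    and "slowly_varying l"
    and "\<forall>h\<ge>1. tail D h = l h * h powr (1 - \<tau>)"
    and "3 \<le> k"
  shows "avg_cliques D k \<asymp> (\<lambda>n. real n ^ k * tail D (sqrt (real n)) ^ k) \<and>
    (\<forall>n\<ge>1. real n ^ k * tail D (sqrt (real n)) ^ k =
             real n powr (real k / 2 * (3 - \<tau>)) * l (sqrt (real n)) ^ k)"
proof
  interpret real_distribution D by fact
  let ?\<alpha> = "\<tau> - 1"
  have rv: "((\<lambda>h. tail D (c * h) / tail D h) \<longlongrightarrow> c powr - ?\<alpha>) at_top" if "0 < c" for c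
    using tail_ratio_tendsto[of l D "1 - \<tau>" c] assms that by simp
  \<comment> \<open>The lower bound \<open>2 * ?\<alpha> - 2\<close> is what
    \<open>?\<alpha> < 1 + b / 2\<close> demands. The interval for \<open>b\<close> is nonempty
    because \<tau> > 2 gives \<open>1 < ?\<alpha>\<close> and \<tau> < 3 gives
    \<open>2 * ?\<alpha> - 2 < ?\<alpha>\<close>.\<close>
  obtain b where b: "max 1 (2 * ?\<alpha> - 2) < b" "b < ?\<alpha>"
    using dense[of "max 1 (2 * ?\<alpha> - 2)" ?\<alpha>] assms by auto
  then have b': "1 \<le> b" "b \<le> 2" "?\<alpha> < 1 + b / 2" using assms by auto
  let ?g = "\<lambda>s h. min ((h / s) powr (1 + b / 2)) ((h / s) powr b)"
  obtain C x\<^sub>0 where mom: "0 < x\<^sub>0"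
    "\<And>s. x\<^sub>0 \<le> s \<Longrightarrow> 0 < tail D s \<and> integrable D (?g s) \<and> integral\<^sup>L D (?g s) \<le> C * tail D s"
    using weight_moment_le_tail(1)[OF assms(2) rv b'(1) b(2) b'(3)] by auto
  have \<mu>: "1 \<le> mean D"
    by (intro integrable_one_le_mean assms weight_moment_le_tail(2)[OF assms(2) rv b'(1) b(2) b'(3)]) simp
  \<comment> \<open>The natural threshold is \<open>c * sqrt (real n)\<close>, while the claim uses
    \<open>sqrt (real n)\<close>; \<open>q\<close> is the limiting ratio of the two tails.\<close>
  define c where "c = sqrt (mean D)"
  define q where "q = c powr - ?\<alpha>"
  have c: "1 \<le> c" and q: "0 < q" using \<mu> by (auto simp: c_def q_def)
  \<comment> \<open>The sign allows a tail estimate to be multiplied by \<open>C\<close> in the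
    upper bound.\<close>
  have C: "0 \<le> C"
  proof -
    have "0 \<le> integral\<^sup>L D (?g x\<^sub>0)" by (intro integral_nonneg_AE) auto
    then have "0 \<le> C * tail D x\<^sub>0" using mom(2)[of x\<^sub>0] by linarith
    then show ?thesis using mom(2)[of x\<^sub>0] by (simp add: zero_le_mult_iff)
  qed
  have sqrt_top: "filterlim (\<lambda>n. sqrt (real n)) at_top sequentially"
    by (rule filterlim_compose[OF sqrt_at_top filterlim_real_sequentially])
  have lim: "((\<lambda>n. tail D (c * sqrt (real n)) / tail D (sqrt (real n))) \<longlonglongrightarrow> q)"
    unfolding q_def using c by (intro filterlim_compose[OF rv sqrt_top]) simp
  have ev: "\<forall>\<^sub>F n in sequentially. q / 2 < tail D (c * sqrt (real n)) / tail D (sqrt (real n))"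
    "\<forall>\<^sub>F n in sequentially. tail D (c * sqrt (real n)) / tail D (sqrt (real n)) < 2 * q"
    using q by (intro order_tendstoD[OF lim]; simp)+
  show "avg_cliques D k \<asymp> (\<lambda>n. real n ^ k * tail D (sqrt (real n)) ^ k)"
  proof (rule same_orderI)
    \<comment> \<open>The factor \<open>(1 / real k) ^ k\<close> comes from bounding the binomial
      coefficient below by \<open>(real n / real k) ^ k\<close>; above, \<open>real n ^ k\<close>
      suffices. The values \<open>q / 2\<close> and \<open>2 * q\<close> bracket the ratio of the
      tails.\<close>
    show "0 < (1 / real k) ^ k * (q / 2) ^ k" using q assms by simp
    show "\<forall>\<^sub>F n in sequentially.
      (1 / real k) ^ k * (q / 2) ^ k \<le> avg_cliques D k n / (real n ^ k * tail D (sqrt (real n)) ^ k) \<and>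
      avg_cliques D k n / (real n ^ k * tail D (sqrt (real n)) ^ k) \<le> (C * (2 * q)) ^ k"
      using ev eventually_ge_at_top[of k] filterlim_at_top[THEN iffD1, OF sqrt_top, THEN spec, of x\<^sub>0]
    proof eventually_elim
      case (elim n)
      let ?F = "tail D (sqrt (real n))"
      let ?P = "clique_prob D k n"
      let ?B = "real (n choose k)"
      have n: "0 < n" using elim assms by simp
      have F: "0 < ?F" using mom(2) elim by simp
      have cs: "sqrt (mean D * real n) = c * sqrt (real n)"
        by (simp add: c_def real_sqrt_mult)
      have "sqrt (real n) \<le> c * sqrt (real n)"
        using c by (intro mult_le_cancel_right1[THEN iffD2]) auto
      then have cx: "x\<^sub>0 \<le> c * sqrt (real n)" using elim by linarith
      have "(q / 2 * ?F) ^ k \<le> tail D (c * sqrt (real n)) ^ k"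
        using elim F q by (intro power_mono) (auto simp: field_simps)
      also have "\<dots> \<le> ?P"
        using tail_power_le_clique_prob[OF assms(2), of n k] \<mu> n by (simp add: cs)
      finally have P_ge: "(q / 2 * ?F) ^ k \<le> ?P" .
      have "?P \<le> integral\<^sup>L D (?g (c * sqrt (real n))) ^ k"
        using clique_prob_le_weight_moment_power[OF assms(2) _ n b'(1,2) assms(7)] mom(2)[OF cx] \<mu>
        by (simp add: cs)
      also have "\<dots> \<le> (C * tail D (c * sqrt (real n))) ^ k"
        using mom(2)[OF cx] by (intro power_mono integral_nonneg_AE) auto
      also have "\<dots> \<le> (C * (2 * q * ?F)) ^ k"
        using elim F C by (intro power_mono mult_left_mono) (auto simp: field_simps tail_nonneg)
      finally have P_le: "?P \<le> (C * (2 * q)) ^ k * ?F ^ k"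
        by (simp add: power_mult_distrib mult_ac)
      have B_ge: "(real n / real k) ^ k \<le> ?B"
        using binomial_ge_n_over_k_pow_k[of k n, where ?'a = real] elim by simp
      have B_le: "?B \<le> real n ^ k"
        using binomial_le_pow[of k n] elim by (simp flip: of_nat_power)
      have P0: "0 \<le> ?P" using P_ge F q by (auto intro: order_trans[rotated])
      have "(1 / real k) ^ k * (q / 2) ^ k * (real n ^ k * ?F ^ k) =
          (real n / real k) ^ k * (q / 2 * ?F) ^ k"
        by (simp add: power_mult_distrib power_divide)
      also have "\<dots> \<le> ?B * ?P"
        using F q by (intro mult_mono B_ge P_ge) auto
      finally have lower: "(1 / real k) ^ k * (q / 2) ^ k * (real n ^ k * ?F ^ k) \<le> ?B * ?P" .
      have "?B * ?P \<le> real n ^ k * ((C * (2 * q)) ^ k * ?F ^ k)"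
        using P0 by (intro mult_mono B_le P_le) auto
      then have "?B * ?P \<le> (C * (2 * q)) ^ k * (real n ^ k * ?F ^ k)"
        by (simp only: mult_ac)
      moreover have "0 < real n ^ k * ?F ^ k" using n F by simp
      ultimately show ?case
        using lower unfolding avg_cliques_eq[OF assms(2)]
        by (simp only: pos_le_divide_eq pos_divide_le_eq simp_thms)
    qed
  qed
  show "\<forall>n\<ge>1. real n ^ k * tail D (sqrt (real n)) ^ k =
             real n powr (real k / 2 * (3 - \<tau>)) * l (sqrt (real n)) ^ k"
  proof (intro allI impI)
    fix n :: nat assume n: "1 \<le> n"
    \<comment> \<open>One vertex contributes the exponent 1 + (1 - \<tau>) / 2 = (3 - \<tau>) / 2;
      the claim is the \<open>k\<close>-th power of this identity.\<close>
    have "real n * sqrt (real n) powr (1 - \<tau>) = real n powr 1 * real n powr (1 / 2 * (1 - \<tau>))"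
      using n by (simp add: powr_powr flip: powr_half_sqrt)
    also have "\<dots> = real n powr ((3 - \<tau>) / 2)"
      by (subst powr_add[symmetric]) (simp add: field_simps)
    finally have "real n * tail D (sqrt (real n)) = real n powr ((3 - \<tau>) / 2) * l (sqrt (real n))"
      using n assms(6) by (simp add: mult_ac)
    then have "(real n * tail D (sqrt (real n))) ^ k =
        (real n powr ((3 - \<tau>) / 2)) ^ k * l (sqrt (real n)) ^ k"
      by (simp add: power_mult_distrib)
    moreover have "(real n powr ((3 - \<tau>) / 2)) ^ k = real n powr (real k / 2 * (3 - \<tau>))"
      using n by (simp add: powr_powr mult_ac flip: powr_realpow)
    ultimately show "real n ^ k * tail D (sqrt (real n)) ^ k =
        real n powr (real k / 2 * (3 - \<tau>)) * l (sqrt (real n)) ^ k"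
      by (simp add: power_mult_distrib)
  qed
qed

end
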